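(* Let $A:\mathbb{Z}^{+}\to M_d(\mathbb{R})$ and $f:\mathbb{Z}^{+}\times\mathbb{R}^d\to\mathbb{R}^d$ (with each $f(k,\cdot)$ continuous), and consider the nonlinear system $$(N)\quad y_{k+1}=A(k)y_k+f(k,y_k),\qquad k\in\mathbb{Z}^{+}.$$ Assume that: (P1) every $A(k)$ is invertible and there exists $M\ge 1$ with $\max\{\sup_{k\in\mathbb{Z}^{+}}\|A(k)\|,\ \sup_{k\in\mathbb{Z}^{+}}\|A^{-1}(k)\|\}=M$. (P3) There are sequences $\gamma,\mu$ of nonnegative reals such that for all $k\in\mathbb{Z}^{+}$ and $y,\tilde y\in\mathbb{R}^d$: $|f(k,y)-f(k,\tilde y)|\le\gamma(k)|y-\tilde y|$ and $|f(k,y)|\le\mu(k)$. (P6) $\|A^{-1}(\ell)\|\,\gamma(\ell)<1$ for all $\ell\in\mathbb{Z}^{+}$. (S1) There exist a bounded sequence $\rho$ of nonnegative reals and a decreasing sequence $h$ of positive reals converging to zero with $h(0)=1$ such that $\|\Phi(k,n)\|\le\rho(n)\frac{h(k)}{h(n)}$ for all $k\ge n\ge 0$. (S2) There is $p<\infty$ with $\sum_{j=0}^{k-1}\mu(j)\rho(j+1)\frac{h(k)}{h(j+1)}\le p$ for all $k\in\mathbb{Z}^{+}$. (S3) There is $q<1$ with $\sum_{j=0}^{k-1}\gamma(j)\rho(j+1)\frac{h(k)}{h(j+1)}\le q$ for all $k\in\mathbb{Z}^{+}$. (S4) $\displaystyle\lim_{k\to+\infty}h(k)\prod_{j=0}^{k-1}\Big(1+\gamma(j)\rho(j+1)\frac{h(j)}{h(j+1)}\Big)=0$.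 If the nonlinear system $(N)$ has an equilibrium $y^{*}$, then $y^{*}$ is asymptotically stable.
   Context: $\mathbb{Z}^{+}=\{0,1,2,\dots\}$; $|\cdot|$ is a vector norm on $\mathbb{R}^d$ and $\|\cdot\|$ its induced matrix norm; $A^{-1}(k)$ denotes $(A(k))^{-1}$. Transition matrix of $x_{k+1}=A(k)x_k$: $\Phi(k,n)=A(k-1)A(k-2)\cdots A(n)$ if $k>n$; $\Phi(k,k)=I$; $\Phi(k,n)=A^{-1}(k)A^{-1}(k+1)\cdots A^{-1}(n-1)$ if $k<n$. An equilibrium of $(N)$ is a vector $y^{*}\in\mathbb{R}^d$ with $y^{*}=A(n)y^{*}+f(n,y^{*})$ for all $n\in\mathbb{Z}^{+}$. Asymptotic stability is understood in the usual (not necessarily uniform) sense for nonautonomous difference equations: writing $k\mapsto y(k,j,\eta)$ for the solution of $(N)$ with value $\eta$ at $k=j$, for every initial time $j\in\mathbb{Z}^{+}$ and $\varepsilon>0$ there is $\delta=\delta(\varepsilon,j)>0$ such that $|\eta-y^{*}|<\delta$ implies $|y(k,j,\eta)-y^{*}|<\varepsilon$ for all $k\ge j$; and for every $j$ there is $\delta_0=\delta_0(j)>0$ such that $|\eta-y^{*}|<\delta_0$ implies $\lim_{k\to+\infty}y(k,j,\eta)=y^{*}$. *)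

theory Defs
  imports "HOL-Analysis.Analysis"
begin

text \<open>An arbitrary vector norm, in general different from the Euclidean \<^const>\<open>norm\<close>.
  Nonnegativity follows from the three axioms.\<close>

definition vector_norm :: "(real ^ 'd \<Rightarrow> real) \<Rightarrow> bool" where
  "vector_norm N \<longleftrightarrow>
     (\<forall>x. N x = 0 \<longleftrightarrow> x = 0) \<and>
     (\<forall>c x. N (c *\<^sub>R x) = \<bar>c\<bar> * N x) \<and>
     (\<forall>x y. N (x + y) \<le> N x + N y)"

text \<open>Analogue of \<^const>\<open>onorm\<close> for the norm \<open>N\<close>; the vector \<open>x = 0\<close> contributes \<open>0 / 0 = 0\<close>,
  which does not affect the supremum.\<close>

definition induced_norm :: "(real ^ 'd \<Rightarrow> real) \<Rightarrow> real ^ 'd ^ 'd \<Rightarrow> real" where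
  "induced_norm N B = (SUP x. N (B *v x) / N x)"

text \<open>\<open>A (k-1) ** \<dots> ** A n\<close> for \<open>k \<ge> n\<close> and \<open>A\<^sup>-\<^sup>1 k ** \<dots> ** A\<^sup>-\<^sup>1 (n-1)\<close> for \<open>k < n\<close>;
  the product is empty for \<open>k = n\<close>.\<close>

definition transition_matrix :: "(nat \<Rightarrow> real ^ 'd ^ 'd) \<Rightarrow> nat \<Rightarrow> nat \<Rightarrow> real ^ 'd ^ 'd" where
  "transition_matrix A k n =
     (if n \<le> k then foldr (\<lambda>i B. A i ** B) (rev [n..<k]) (mat 1)
      else foldr (\<lambda>i B. matrix_inv (A i) ** B) [k..<n] (mat 1))"

definition equilibrium ::
  "(nat \<Rightarrow> real ^ 'd ^ 'd) \<Rightarrow> (nat \<Rightarrow> real ^ 'd \<Rightarrow> real ^ 'd) \<Rightarrow> real ^ 'd \<Rightarrow> bool" where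
  "equilibrium A f ystar \<longleftrightarrow> (\<forall>n. ystar = A n *v ystar + f n ystar)"

text \<open>Only the values \<open>y k\<close> with \<open>k \<ge> j\<close> are constrained: these are the only ones that enter
  the definition of stability.\<close>

definition solution_from ::
  "(nat \<Rightarrow> real ^ 'd ^ 'd) \<Rightarrow> (nat \<Rightarrow> real ^ 'd \<Rightarrow> real ^ 'd) \<Rightarrow> nat \<Rightarrow> real ^ 'd
    \<Rightarrow> (nat \<Rightarrow> real ^ 'd) \<Rightarrow> bool" where
  "solution_from A f j \<eta> y \<longleftrightarrow>
     y j = \<eta> \<and> (\<forall>k\<ge>j. y (Suc k) = A k *v y k + f k (y k))"

lemma solution_from_exists: "\<exists>y. solution_from A f j \<eta> y"
proof -
  define y where "y k = rec_nat \<eta> (\<lambda>i z. A (j + i) *v z + f (j + i) z) (k - j)" for k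
  have "solution_from A f j \<eta> y"
    by (auto simp: solution_from_def y_def Suc_diff_le)
  then show ?thesis by blast
qed

lemma solution_from_unique:
  assumes "solution_from A f j \<eta> y" "solution_from A f j \<eta> z" "k \<ge> j"
  shows "y k = z k"
  using assms(3) by (induction k rule: dec_induct) (use assms(1,2) in \<open>auto simp: solution_from_def\<close>)

definition asymptotically_stable ::
  "(real ^ 'd \<Rightarrow> real) \<Rightarrow> (nat \<Rightarrow> real ^ 'd ^ 'd) \<Rightarrow> (nat \<Rightarrow> real ^ 'd \<Rightarrow> real ^ 'd)
    \<Rightarrow> real ^ 'd \<Rightarrow> bool" where
  "asymptotically_stable N A f ystar \<longleftrightarrow>
     (\<forall>j. \<forall>\<epsilon>>0. \<exists>\<delta>>0. \<forall>\<eta> y. solution_from A f j \<eta> y \<longrightarrow> N (\<eta> - ystar) < \<delta> \<longrightarrow>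
        (\<forall>k\<ge>j. N (y k - ystar) < \<epsilon>)) \<and>
     (\<forall>j. \<exists>\<delta>\<^sub>0>0. \<forall>\<eta> y. solution_from A f j \<eta> y \<longrightarrow> N (\<eta> - ystar) < \<delta>\<^sub>0 \<longrightarrow>
        y \<longlonglongrightarrow> ystar)"

end

theory Submission imports Defs
begin

text \<open>Let \<open>z k\<close> be the deviation of a solution from the equilibrium. It solves the linear system
  \<open>z (Suc k) = A k z k + g k\<close>, where \<open>g k = f k (y k) - f k ystar\<close> is at most \<open>\<gamma> k\<close> times
  \<open>z k\<close> in norm. The variation of constants formula and the bound on the transition matrix give
  \<open>|z k| \<le> \<rho> j h k / h j |z j| + \<Sum> \<gamma> i \<rho> (i+1) h k / h (i+1) |z i|\<close>, with \<open>i\<close> ranging from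
  the initial time \<open>j\<close> to \<open>k - 1\<close>.

  Dividing by \<open>h k\<close> turns this into an inequality of Gronwall type for \<open>|z k| / h k\<close> whose
  coefficients \<open>\<gamma> i \<rho> (i+1) h i / h (i+1)\<close> are independent of \<open>k\<close>. Hence \<open>|z k|\<close> is at
  most \<open>\<rho> j / h j |z j|\<close> times the expression \<open>h k \<Prod>\<^sub>i (1 + \<dots>)\<close> (lemma
  \<open>perturbed_linear_decay\<close>). That expression tends to zero, so every solution is attracted, and it
  is bounded, so a small initial deviation remains small.

  As stability is measured in \<open>N\<close> but convergence in the Euclidean norm, the two norms have to be
  compared (\<open>norm_le_vector_norm\<close>); the comparison also makes the supremum that defines the
  induced norm finite.\<close>

section \<open>Vector norms and their induced matrix norms\<close>

lemma vector_norm_zero: "vector_norm N \<Longrightarrow> N 0 = 0"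
  by (simp add: vector_norm_def)

lemma vector_norm_scaleR: "vector_norm N \<Longrightarrow> N (c *\<^sub>R x) = \<bar>c\<bar> * N x"
  by (simp add: vector_norm_def)

lemma vector_norm_triangle: "vector_norm N \<Longrightarrow> N (x + y) \<le> N x + N y"
  by (simp add: vector_norm_def)

lemma vector_norm_minus: "vector_norm N \<Longrightarrow> N (- x) = N x"
  using vector_norm_scaleR[of N "-1" x] by simp

lemma vector_norm_nonneg:
  assumes "vector_norm N" shows "N x \<ge> 0"
  using vector_norm_triangle[OF assms, of x "- x"] assms
  by (simp add: vector_norm_minus vector_norm_zero)

lemma vector_norm_pos:
  assumes "vector_norm N" "x \<noteq> 0" shows "N x > 0"
  using assms vector_norm_nonneg[OF assms(1), of x] by (auto simp: vector_norm_def less_le)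

lemma vector_norm_sum:
  assumes "vector_norm N" shows "N (\<Sum>i\<in>S. g i) \<le> (\<Sum>i\<in>S. N (g i))"
proof (induction S rule: infinite_finite_induct)
  case (insert i S)
  then show ?case using vector_norm_triangle[OF assms, of "g i" "sum g S"] by simp
qed (use assms in \<open>simp_all add: vector_norm_zero\<close>)

lemma vector_norm_le_norm:
  fixes N :: "real ^ 'd \<Rightarrow> real"
  assumes N: "vector_norm N"
  obtains C where "C > 0" "\<And>x. N x \<le> C * norm x"
proof
  let ?C = "1 + (\<Sum>i\<in>UNIV. N (axis i 1))"
  show "?C > 0"
    by (intro add_pos_nonneg sum_nonneg vector_norm_nonneg[OF N]) simp
  fix x :: "real ^ 'd"
  have "N x = N (\<Sum>i\<in>UNIV. (x $ i) *\<^sub>R axis i 1)"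
    using basis_expansion[of x] by (simp add: scalar_mult_eq_scaleR)
  also have "\<dots> \<le> (\<Sum>i\<in>UNIV. \<bar>x $ i\<bar> * N (axis i 1))"
    using vector_norm_sum[OF N, of "\<lambda>i. (x $ i) *\<^sub>R axis i 1" UNIV]
    by (simp add: vector_norm_scaleR[OF N])
  also have "\<dots> \<le> (\<Sum>i\<in>UNIV. norm x * N (axis i 1))"
    by (intro sum_mono mult_right_mono component_le_norm_cart vector_norm_nonneg[OF N])
  also have "\<dots> \<le> ?C * norm x"
    by (simp add: sum_distrib_left[symmetric] algebra_simps)
  finally show "N x \<le> ?C * norm x" .
qed

text \<open>\<open>N\<close> is Lipschitz with respect to the Euclidean norm, so it attains a minimum on the compact
  unit sphere; this minimum is positive, and scaling extends the bound to all vectors.\<close>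

lemma norm_le_vector_norm:
  fixes N :: "real ^ 'd \<Rightarrow> real"
  assumes N: "vector_norm N"
  obtains D where "D > 0" "\<And>x. norm x \<le> D * N x"
proof -
  obtain C where C: "C > 0" "\<And>x. N x \<le> C * norm x"
    using vector_norm_le_norm[OF N] by blast
  have "\<bar>N x - N y\<bar> \<le> C * norm (x - y)" for x y
    using vector_norm_triangle[OF N, of "x - y" y] vector_norm_triangle[OF N, of "y - x" x]
      C(2)[of "x - y"] C(2)[of "y - x"] by (simp add: norm_minus_commute)
  then have "C-lipschitz_on UNIV N"
    using C(1) by (intro lipschitz_onI) (auto simp: dist_norm)
  then have cont: "continuous_on (sphere 0 1) N"
    using lipschitz_on_continuous_on continuous_on_subset by blast
  have "axis undefined 1 \<in> sphere (0 :: real ^ 'd) 1" by (simp add: norm_axis_1)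
  then obtain a :: "real ^ 'd" where a: "a \<in> sphere 0 1" "\<And>x. x \<in> sphere 0 1 \<Longrightarrow> N a \<le> N x"
    using continuous_attains_inf[OF compact_sphere _ cont] by blast
  have pos: "N a > 0" using a(1) by (intro vector_norm_pos[OF N]) auto
  have "norm x \<le> 1 / N a * N x" for x
  proof (cases "x = 0")
    case False
    then have "N a \<le> N ((1 / norm x) *\<^sub>R x)" by (intro a(2)) simp
    then show ?thesis using pos False by (simp add: vector_norm_scaleR[OF N] field_simps)
  qed (simp add: vector_norm_zero[OF N])
  with pos show thesis by (intro that[of "1 / N a"]) auto
qed

lemma induced_norm_bound:
  assumes N: "vector_norm N"
  shows "N (B *v x) \<le> induced_norm N B * N x"
proof (cases "x = 0")
  case True
  then show ?thesis by (simp add: vector_norm_zero[OF N])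
next
  case False
  obtain C where C: "C > 0" "\<And>x. N x \<le> C * norm x"
    using vector_norm_le_norm[OF N] by blast
  obtain D where D: "D > 0" "\<And>x. norm x \<le> D * N x"
    using norm_le_vector_norm[OF N] by blast
  obtain K where K: "K > 0" "\<And>x. norm (B *v x) \<le> norm x * K"
    using bounded_linear.pos_bounded[OF matrix_vector_mul_bounded_linear] by blast
  have "N (B *v v) / N v \<le> C * K * D" for v
  proof (cases "v = 0")
    case False
    have "N (B *v v) \<le> C * norm (B *v v)" by (rule C)
    also have "\<dots> \<le> C * (norm v * K)" using K C by (intro mult_left_mono) auto
    also have "\<dots> \<le> C * (D * N v * K)"
      using K C D by (intro mult_left_mono mult_right_mono) auto
    finally show ?thesis
      using vector_norm_pos[OF N False] by (simp add: field_simps)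
  qed (use C(1) D(1) K(1) in \<open>simp add: vector_norm_zero[OF N]\<close>)
  then have "bdd_above (range (\<lambda>v. N (B *v v) / N v))" by (intro bdd_aboveI2) auto
  then have "N (B *v x) / N x \<le> induced_norm N B"
    unfolding induced_norm_def by (intro cSUP_upper) auto
  then show ?thesis using vector_norm_pos[OF N False] by (simp add: field_simps)
qed

section \<open>Variation of constants and the discrete Gronwall inequality\<close>

lemma transition_matrix_refl: "transition_matrix A n n = mat 1"
  by (simp add: transition_matrix_def)

lemma transition_matrix_Suc:
  "n \<le> k \<Longrightarrow> transition_matrix A (Suc k) n = A k ** transition_matrix A k n"
  by (simp add: transition_matrix_def)

lemma variation_of_constants:
  assumes z: "\<And>k. k \<ge> j \<Longrightarrow> z (Suc k) = A k *v z k + g k" and "k \<ge> j"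
  shows "z k = transition_matrix A k j *v z j
               + (\<Sum>i=j..<k. transition_matrix A k (Suc i) *v g i)"
  using \<open>k \<ge> j\<close>
proof (induction k rule: dec_induct)
  case base
  then show ?case by (simp add: transition_matrix_refl)
next
  case (step k)
  have "(\<Sum>i=j..<k. transition_matrix A (Suc k) (Suc i) *v g i)
      = A k *v (\<Sum>i=j..<k. transition_matrix A k (Suc i) *v g i)"
    by (simp add: linear_sum[OF matrix_vector_mul_linear] transition_matrix_Suc
        matrix_vector_mul_assoc)
  with step show ?case
    by (simp add: z transition_matrix_Suc transition_matrix_refl matrix_vector_right_distrib
        matrix_vector_mul_assoc)
qed

text \<open>The right-hand side \<open>c + \<Sum> b i * u i\<close> of the hypothesis grows by a factor of at most
  \<open>1 + b k\<close> in each step, so it is the quantity to induct on.\<close>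

lemma discrete_Gronwall:
  fixes u b :: "nat \<Rightarrow> real"
  assumes u: "\<And>k. k \<ge> j \<Longrightarrow> u k \<le> c + (\<Sum>i=j..<k. b i * u i)"
    and b: "\<And>i. b i \<ge> 0" and "k \<ge> j"
  shows "u k \<le> c * (\<Prod>i=j..<k. 1 + b i)"
proof -
  have "c + (\<Sum>i=j..<k. b i * u i) \<le> c * (\<Prod>i=j..<k. 1 + b i)"
    using \<open>k \<ge> j\<close>
  proof (induction k rule: dec_induct)
    case (step k)
    let ?S = "c + (\<Sum>i=j..<k. b i * u i)"
    have "c + (\<Sum>i=j..<Suc k. b i * u i) = ?S + b k * u k" using step by simp
    also have "\<dots> \<le> ?S + b k * ?S" using u[of k] b[of k] step by (intro add_left_mono mult_left_mono)
    also have "\<dots> = ?S * (1 + b k)" by (simp add: algebra_simps)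
    also have "\<dots> \<le> c * (\<Prod>i=j..<k. 1 + b i) * (1 + b k)"
      using step b[of k] by (intro mult_right_mono) auto
    finally show ?case using step by (simp add: mult.assoc)
  qed simp
  with u[OF \<open>k \<ge> j\<close>] show ?thesis by linarith
qed

section \<open>Decay of perturbed linear systems\<close>

text \<open>Gronwall's inequality applies to \<open>N (z k) / h k\<close>, for which the kernel
  \<open>\<gamma> i * \<rho> (i + 1) * h k / h (i + 1)\<close> loses its dependence on \<open>k\<close>. It bounds the growth by the
  product over \<open>j \<le> i < k\<close>; all factors are at least 1, so the product may be started at 0, which
  makes the resulting expression the same for every initial time.\<close>

lemma perturbed_linear_decay:
  fixes A :: "nat \<Rightarrow> real ^ 'd ^ 'd"
  assumes N: "vector_norm N"
    and z: "\<And>k. k \<ge> j \<Longrightarrow> z (Suc k) = A k *v z k + g k"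
    and g: "\<And>k. N (g k) \<le> \<gamma> k * N (z k)"
    and \<gamma>: "\<And>k. \<gamma> k \<ge> 0" and \<rho>: "\<And>n. \<rho> n \<ge> 0" and h: "\<And>k. h k > 0"
    and \<Phi>: "\<And>k n. k \<ge> n \<Longrightarrow> induced_norm N (transition_matrix A k n) \<le> \<rho> n * (h k / h n)"
    and "k \<ge> j"
  shows "N (z k) \<le> \<rho> j / h j * N (z j)
           * (h k * (\<Prod>i<k. 1 + \<gamma> i * \<rho> (i + 1) * (h i / h (i + 1))))"
proof -
  note nonneg = vector_norm_nonneg[OF N]
  define b where "b i = \<gamma> i * \<rho> (i + 1) * (h i / h (i + 1))" for i
  have b: "b i \<ge> 0" for i
    unfolding b_def using \<gamma> \<rho> h by (simp add: less_imp_le)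
  have \<Phi>_bound: "N (transition_matrix A k n *v v) \<le> \<rho> n * (h k / h n) * N v" if "n \<le> k" for k n v
    using induced_norm_bound[OF N] mult_right_mono[OF \<Phi>[OF that] nonneg] by (rule order_trans)
  have ineq: "N (z k) / h k \<le> \<rho> j / h j * N (z j) + (\<Sum>i=j..<k. b i * (N (z i) / h i))"
    if "k \<ge> j" for k
  proof -
    have term_bound: "N (transition_matrix A k (Suc i) *v g i) \<le> h k * (b i * (N (z i) / h i))"
      if "i < k" for i
    proof -
      have "N (transition_matrix A k (Suc i) *v g i) \<le> \<rho> (Suc i) * (h k / h (Suc i)) * N (g i)"
        using that by (intro \<Phi>_bound) simp
      also have "\<dots> \<le> \<rho> (Suc i) * (h k / h (Suc i)) * (\<gamma> i * N (z i))"
        using \<rho> h by (intro mult_left_mono g) (simp add: less_imp_le)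
      also have "\<dots> = h k * (b i * (N (z i) / h i))"
        using h[of i] by (simp add: b_def)
      finally show ?thesis .
    qed
    have "N (z k) \<le> N (transition_matrix A k j *v z j)
        + N (\<Sum>i=j..<k. transition_matrix A k (Suc i) *v g i)"
      using variation_of_constants[of j z A g k, OF z that] vector_norm_triangle[OF N] by simp
    also have "\<dots> \<le> \<rho> j * (h k / h j) * N (z j)
        + (\<Sum>i=j..<k. N (transition_matrix A k (Suc i) *v g i))"
      by (intro add_mono \<Phi>_bound vector_norm_sum[OF N] that)
    also have "\<dots> \<le> \<rho> j * (h k / h j) * N (z j) + (\<Sum>i=j..<k. h k * (b i * (N (z i) / h i)))"
      by (intro add_left_mono sum_mono term_bound) simp
    also have "\<dots> = h k * (\<rho> j / h j * N (z j) + (\<Sum>i=j..<k. b i * (N (z i) / h i)))"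
      by (simp add: sum_distrib_left algebra_simps)
    finally show ?thesis using h[of k] by (simp add: pos_divide_le_eq mult.commute)
  qed
  have "N (z k) / h k \<le> \<rho> j / h j * N (z j) * (\<Prod>i=j..<k. 1 + b i)"
    using discrete_Gronwall[of j "\<lambda>k. N (z k) / h k", OF ineq b \<open>k \<ge> j\<close>] .
  also have "\<dots> \<le> \<rho> j / h j * N (z j) * (\<Prod>i<k. 1 + b i)"
  proof (intro mult_left_mono prod_mono2)
    show "0 \<le> \<rho> j / h j * N (z j)" using \<rho> h nonneg by (simp add: less_imp_le)
  qed (use b in \<open>auto simp: add_nonneg_nonneg\<close>)
  finally show ?thesis
    using h[of k] by (simp add: b_def pos_divide_le_eq ac_simps)
qed

section \<open>Stability of the equilibrium\<close>

theorem corollary4: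
  fixes N :: "real ^ 'd \<Rightarrow> real"
    and A :: "nat \<Rightarrow> real ^ 'd ^ 'd"
    and f :: "nat \<Rightarrow> real ^ 'd \<Rightarrow> real ^ 'd"
    and \<gamma> \<mu> \<rho> h :: "nat \<Rightarrow> real"
    and ystar :: "real ^ 'd"
  assumes N: "vector_norm N"
    and f_cont: "\<And>k. continuous_on UNIV (f k)"
    and P1_inv: "\<And>k. invertible (A k)"
    and P1_bound: "\<exists>M\<ge>1. max (SUP k. ereal (induced_norm N (A k)))
                            (SUP k. ereal (induced_norm N (matrix_inv (A k)))) = ereal M"
    and P3_nonneg: "\<And>k. \<gamma> k \<ge> 0" "\<And>k. \<mu> k \<ge> 0"
    and P3_lip: "\<And>k y y'. N (f k y - f k y') \<le> \<gamma> k * N (y - y')"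
    and P3_bound: "\<And>k y. N (f k y) \<le> \<mu> k"
    and P6: "\<And>l. induced_norm N (matrix_inv (A l)) * \<gamma> l < 1"
    and S1_rho: "\<And>n. \<rho> n \<ge> 0" "bounded (range \<rho>)"
    and S1_h: "\<And>k. h k > 0" "decseq h" "h \<longlonglongrightarrow> 0" "h 0 = 1"
    and S1: "\<And>k n. k \<ge> n \<Longrightarrow> induced_norm N (transition_matrix A k n) \<le> \<rho> n * (h k / h n)"
    and S2: "\<exists>p::real. \<forall>k. (\<Sum>j<k. \<mu> j * \<rho> (j + 1) * (h k / h (j + 1))) \<le> p"
    and S3: "\<exists>q<1. \<forall>k. (\<Sum>j<k. \<gamma> j * \<rho> (j + 1) * (h k / h (j + 1))) \<le> q"
    and S4: "(\<lambda>k. h k * (\<Prod>j<k. 1 + \<gamma> j * \<rho> (j + 1) * (h j / h (j + 1)))) \<longlonglongrightarrow> 0"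
    and equil: "equilibrium A f ystar"
  shows "asymptotically_stable N A f ystar"
proof -
  define P where "P k = h k * (\<Prod>j<k. 1 + \<gamma> j * \<rho> (j + 1) * (h j / h (j + 1)))" for k
  have P_lim: "P \<longlonglongrightarrow> 0" unfolding P_def by (rule S4)
  have decay: "N (y k - ystar) \<le> \<rho> j / h j * N (\<eta> - ystar) * P k"
    if sol: "solution_from A f j \<eta> y" and "k \<ge> j" for j \<eta> y k
  proof -
    have "y (Suc k) - ystar = A k *v (y k - ystar) + (f k (y k) - f k ystar)" if "k \<ge> j" for k
    proof -
      have "y (Suc k) = A k *v y k + f k (y k)" using sol that by (simp add: solution_from_def)
      moreover have "ystar = A k *v ystar + f k ystar" using equil by (simp add: equilibrium_def)
      ultimately show ?thesis by (simp add: matrix_vector_mult_diff_distrib algebra_simps)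
    qed
    from perturbed_linear_decay[of N j "\<lambda>k. y k - ystar" A, OF N this P3_lip P3_nonneg(1)
        S1_rho(1) S1_h(1) S1 \<open>k \<ge> j\<close>]
    show ?thesis using sol by (simp add: P_def solution_from_def)
  qed
  have stable: "\<exists>\<delta>>0. \<forall>\<eta> y. solution_from A f j \<eta> y \<longrightarrow> N (\<eta> - ystar) < \<delta> \<longrightarrow>
      (\<forall>k\<ge>j. N (y k - ystar) < \<epsilon>)" if "\<epsilon> > 0" for j and \<epsilon> :: real
  proof -
    obtain K where K: "K > 0" "\<And>k. norm (P k) \<le> K"
      using convergent_imp_Bseq[OF convergentI[OF P_lim]] unfolding Bseq_def by blast
    have c: "\<rho> j / h j \<ge> 0" using S1_rho(1) S1_h(1) by (simp add: less_imp_le)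
    \<comment> \<open>The summand 1 only serves to make \<open>L\<close> visibly positive.\<close>
    define L where "L = \<rho> j / h j * K + 1"
    have L: "L > 0" unfolding L_def using c K(1) by (intro add_nonneg_pos mult_nonneg_nonneg) auto
    have "N (y k - ystar) < \<epsilon>"
      if sol: "solution_from A f j \<eta> y" and \<eta>: "N (\<eta> - ystar) < \<epsilon> / L" and k: "k \<ge> j" for \<eta> y k
    proof -
      have n: "N (\<eta> - ystar) \<ge> 0" by (rule vector_norm_nonneg[OF N])
      have "N (y k - ystar) \<le> \<rho> j / h j * N (\<eta> - ystar) * P k" by (rule decay[OF sol k])
      also have "\<dots> \<le> \<rho> j / h j * N (\<eta> - ystar) * K"
        using K(2)[of k] by (intro mult_left_mono mult_nonneg_nonneg c n) simp
      also have "\<dots> \<le> L * N (\<eta> - ystar)" using n by (simp add: L_def algebra_simps)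
      also have "\<dots> < \<epsilon>" using \<eta> L by (simp add: field_simps)
      finally show ?thesis .
    qed
    with L \<open>\<epsilon> > 0\<close> show ?thesis by (intro exI[of _ "\<epsilon> / L"]) auto
  qed
  have attracted: "y \<longlonglongrightarrow> ystar" if sol: "solution_from A f j \<eta> y" for j \<eta> y
  proof -
    obtain D where D: "D > 0" "\<And>x. norm x \<le> D * N x"
      using norm_le_vector_norm[OF N] by blast
    have "norm (y k - ystar) \<le> D * (\<rho> j / h j * N (\<eta> - ystar) * P k)" if "k \<ge> j" for k
      using D(2)[of "y k - ystar"] mult_left_mono[OF decay[OF sol that], of D] D(1) by linarith
    then have "eventually (\<lambda>k. norm (y k - ystar) \<le> D * (\<rho> j / h j * N (\<eta> - ystar) * P k)) sequentially"
      by (auto intro: eventually_sequentiallyI)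
    moreover have "(\<lambda>k. D * (\<rho> j / h j * N (\<eta> - ystar) * P k)) \<longlonglongrightarrow> 0"
      by (intro tendsto_mult_right_zero P_lim)
    ultimately have "(\<lambda>k. y k - ystar) \<longlonglongrightarrow> 0" by (rule Lim_null_comparison)
    then show ?thesis by (simp add: LIM_zero_iff)
  qed
  show ?thesis
    unfolding asymptotically_stable_def using stable attracted zero_less_one by blast
qed

end
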